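(* Let $\mathcal{M}$ be a linearly ordered complete q-effect algebra with underlying set $M$, let $(S,R)$ be a time frame, and let $G^*,H^*:M^S\to M^S$ be defined by $$G^*(p)(s)=\bigwedge\{p(t)\mid t\in S,\ sRt\},\qquad H^*(p)(s)=\bigwedge\{p(t)\mid t\in S,\ tRs\}$$ for all $p\in M^S$ and $s\in S$. Then $G^*$ and $H^*$ are q-tense operators on $\mathcal{M}^S$, and $G^*$ (respectively $H^*$) has a left adjoint $P^*$ (respectively $F^*$). In this case, for all $r\in M^S$ and $t\in S$, $$P^*(r)(t)=\bigvee\{r(s)\mid s\in S,\ sRt\},\qquad F^*(r)(t)=\bigvee\{r(s)\mid s\in S,\ tRs\}.$$ Moreover: (i) if $R$ is reflexive then $G^*(p)\leq p$, $H^*(p)\leq p$, $r\leq P^*(r)$ and $r\leq F^*(r)$ for all $p,r\in M^S$; (ii) if $R$ is symmetric then $G^*=H^*$ and $P^*=F^*$; (iii) if $R$ is transitive then $G^*G^*(p)\geq G^*(p)$, $H^*H^*(p)\geq H^*(p)$, $P^*P^*(r)\leq P^*(r)$ and $F^*F^*(r)\leq F^*(r)$ for all $p,r\in M^S$.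
   Context: An effect algebra is a structure $(E;+,0,1)$ with distinguished elements $0\neq 1$ of $E$ and a partial binary operation $+$ such that for $x,y,z\in E$: (E1) if $x+y$ is defined then $y+x$ is defined and $x+y=y+x$; (E2) if $y+z$ and $x+(y+z)$ are defined then $x+y$ and $(x+y)+z$ are defined and $(x+y)+z=x+(y+z)$; (E3) for each $x$ there is a unique $x'\in E$ with $x+x'=1$; (E4) if $x+1$ is defined then $x=0$. The induced order is $x\leq y$ iff $x+z=y$ for some $z\in E$; it is a partial order with bottom $0$ and top $1$, and $x+y$ is defined iff $x\leq y'$. The dual partial operation: $x\cdot y$ is defined iff $x'\leq y$, and then $x\cdot y=(x'+y')'$. A q-effect algebra $(E;+,q,d,0,1)$ is an effect algebra with maps $q,d:E\to E$ such that for all $x,y,z\in E$: (Q1) $d(x')=q(x)'$; (Q2) $d(0)=0=q(0)$; (Q3) $d$ is order-preserving; (Q4) $x'\leq x$ implies $x\cdot x=d(x)$; (Q5) $z\leq x$, $z\leq y$ and $y'\leq x$ imply $d(z)\leq x\cdot y$. It is linearly ordered (complete) if its induced order is linear (a complete lattice). The direct power $\mathcal{M}^S$ of a q-effect algebra is a q-effect algebra with all operations and the order componentwise. Empty meets equal $1$ and empty joins equal $0$. A pair $(f,g)$ of maps $f,g:E\to E$ is a Galois connection ($f$ is left adjoint of $g$) if $f(a)\leq b\iff a\leq g(b)$ for all $a,b\in E$, and a Galois q-connection if moreover $f$ and $g$ both commute with $q$ and with $d$. Unary operators $G,H:E\to E$ are q-tense operators on a q-effect algebra if, with $P(x)=H(x')'$,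 the pair $(P,G)$ is a Galois q-connection (then, with $F(x)=G(x')'$, the pair $(F,H)$ is also a Galois q-connection). A time frame is a pair $(S,R)$ with $S$ a non-empty set and $R\subseteq S\times S$. *)

theory Defs
  imports "HOL-Algebra.Galois_Connection"
begin

section \<open>Effect algebras\<close>

text \<open>
  The partial operation is option-valued; \<open>None\<close> means undefined. Only its values on the
  carrier are relevant.
\<close>

record 'a effect_struct = "'a partial_object" +
  eplus :: "'a \<Rightarrow> 'a \<Rightarrow> 'a option"
  ezero :: 'a
  eone  :: 'a

locale effect_algebra =
  fixes E (structure)
  assumes ezero_closed: "ezero E \<in> carrier E"
    and eone_closed: "eone E \<in> carrier E"
    and ezero_neq_eone: "ezero E \<noteq> eone E"
    and eplus_closed:
      "\<lbrakk>x \<in> carrier E; y \<in> carrier E; eplus E x y = Some z\<rbrakk> \<Longrightarrow> z \<in> carrier E"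
    and E1: "\<lbrakk>x \<in> carrier E; y \<in> carrier E; eplus E x y = Some z\<rbrakk> \<Longrightarrow> eplus E y x = Some z"
    and E2: "\<lbrakk>x \<in> carrier E; y \<in> carrier E; z \<in> carrier E;
              eplus E y z = Some u; eplus E x u = Some v\<rbrakk>
              \<Longrightarrow> \<exists>w. eplus E x y = Some w \<and> eplus E w z = Some v"
    and E3: "x \<in> carrier E \<Longrightarrow> \<exists>!y. y \<in> carrier E \<and> eplus E x y = Some (eone E)"
    and E4: "\<lbrakk>x \<in> carrier E; eplus E x (eone E) \<noteq> None\<rbrakk> \<Longrightarrow> x = ezero E"

definition ecompl :: "('a, 'm) effect_struct_scheme \<Rightarrow> 'a \<Rightarrow> 'a"
  where "ecompl E x = (THE y. y \<in> carrier E \<and> eplus E x y = Some (eone E))"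

definition ele :: "('a, 'm) effect_struct_scheme \<Rightarrow> 'a \<Rightarrow> 'a \<Rightarrow> bool" (infixl \<open>\<preceq>\<index>\<close> 50)
  where "x \<preceq>\<^bsub>E\<^esub> y \<longleftrightarrow> (\<exists>z\<in>carrier E. eplus E x z = Some y)"

definition eorder :: "('a, 'm) effect_struct_scheme \<Rightarrow> 'a gorder"
  where "eorder E = \<lparr>carrier = carrier E, eq = (=), le = ele E\<rparr>"

text \<open>
  In an effect algebra \<open>x' + y'\<close> is defined whenever \<open>x' \<le> y\<close>, so \<open>the\<close> is never applied
  to \<open>None\<close> below.
\<close>

definition etimes :: "('a, 'm) effect_struct_scheme \<Rightarrow> 'a \<Rightarrow> 'a \<Rightarrow> 'a option"
  where "etimes E x y =
    (if ecompl E x \<preceq>\<^bsub>E\<^esub> y then Some (ecompl E (the (eplus E (ecompl E x) (ecompl E y)))) else None)"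

section \<open>q-effect algebras and their direct powers\<close>

record 'a q_effect_struct = "'a effect_struct" +
  qop :: "'a \<Rightarrow> 'a"
  dop :: "'a \<Rightarrow> 'a"

locale q_effect_algebra = effect_algebra +
  assumes qop_closed: "qop E \<in> carrier E \<rightarrow> carrier E"
    and dop_closed: "dop E \<in> carrier E \<rightarrow> carrier E"
    and Q1: "x \<in> carrier E \<Longrightarrow> dop E (ecompl E x) = ecompl E (qop E x)"
    and Q2: "dop E (ezero E) = ezero E" "qop E (ezero E) = ezero E"
    and Q3: "\<lbrakk>x \<in> carrier E; y \<in> carrier E; x \<preceq> y\<rbrakk> \<Longrightarrow> dop E x \<preceq> dop E y"
    and Q4: "\<lbrakk>x \<in> carrier E; ecompl E x \<preceq> x\<rbrakk> \<Longrightarrow> etimes E x x = Some (dop E x)"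
    and Q5: "\<lbrakk>x \<in> carrier E; y \<in> carrier E; z \<in> carrier E; z \<preceq> x; z \<preceq> y; ecompl E y \<preceq> x\<rbrakk>
              \<Longrightarrow> \<exists>w. etimes E x y = Some w \<and> dop E z \<preceq> w"

definition q_effect_power :: "'a q_effect_struct \<Rightarrow> 's set \<Rightarrow> ('s \<Rightarrow> 'a) q_effect_struct"
  where "q_effect_power M S =
    \<lparr>carrier = S \<rightarrow>\<^sub>E carrier M,
     eplus = (\<lambda>f g. if \<forall>s\<in>S. eplus M (f s) (g s) \<noteq> None
                    then Some (\<lambda>s\<in>S. the (eplus M (f s) (g s))) else None),
     ezero = (\<lambda>s\<in>S. ezero M),
     eone = (\<lambda>s\<in>S. eone M),
     qop = (\<lambda>f. \<lambda>s\<in>S. qop M (f s)),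
     dop = (\<lambda>f. \<lambda>s\<in>S. dop M (f s))\<rparr>"

section \<open>Galois q-connections and q-tense operators\<close>

definition left_adjoint ::
    "('a, 'm) effect_struct_scheme \<Rightarrow> ('a \<Rightarrow> 'a) \<Rightarrow> ('a \<Rightarrow> 'a) \<Rightarrow> bool"
  where "left_adjoint E f g \<longleftrightarrow>
    galois_connection \<lparr>orderA = eorder E, orderB = eorder E, lower = f, upper = g\<rparr>"

definition commutes_on :: "'a set \<Rightarrow> ('a \<Rightarrow> 'a) \<Rightarrow> ('a \<Rightarrow> 'a) \<Rightarrow> bool"
  where "commutes_on A f h \<longleftrightarrow> (\<forall>x\<in>A. f (h x) = h (f x))"

definition galois_q_connection :: "'a q_effect_struct \<Rightarrow> ('a \<Rightarrow> 'a) \<Rightarrow> ('a \<Rightarrow> 'a) \<Rightarrow> bool"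
  where "galois_q_connection E f g \<longleftrightarrow>
    left_adjoint E f g \<and>
    commutes_on (carrier E) f (qop E) \<and> commutes_on (carrier E) f (dop E) \<and>
    commutes_on (carrier E) g (qop E) \<and> commutes_on (carrier E) g (dop E)"

definition q_tense_operators :: "'a q_effect_struct \<Rightarrow> ('a \<Rightarrow> 'a) \<Rightarrow> ('a \<Rightarrow> 'a) \<Rightarrow> bool"
  where "q_tense_operators E G H \<longleftrightarrow>
    q_effect_algebra E \<and>
    G \<in> carrier E \<rightarrow> carrier E \<and> H \<in> carrier E \<rightarrow> carrier E \<and>
    galois_q_connection E (\<lambda>x. ecompl E (H (ecompl E x))) G"

section \<open>Operators induced by a time frame\<close>

definition time_frame :: "'s set \<Rightarrow> ('s \<times> 's) set \<Rightarrow> bool"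
  where "time_frame S R \<longleftrightarrow> S \<noteq> {} \<and> R \<subseteq> S \<times> S"

definition G_star :: "'a q_effect_struct \<Rightarrow> 's set \<Rightarrow> ('s \<times> 's) set \<Rightarrow> ('s \<Rightarrow> 'a) \<Rightarrow> 's \<Rightarrow> 'a"
  where "G_star M S R p = (\<lambda>s\<in>S. \<Sqinter>\<^bsub>eorder M\<^esub>{p t | t. t \<in> S \<and> (s, t) \<in> R})"

definition H_star :: "'a q_effect_struct \<Rightarrow> 's set \<Rightarrow> ('s \<times> 's) set \<Rightarrow> ('s \<Rightarrow> 'a) \<Rightarrow> 's \<Rightarrow> 'a"
  where "H_star M S R p = (\<lambda>s\<in>S. \<Sqinter>\<^bsub>eorder M\<^esub>{p t | t. t \<in> S \<and> (t, s) \<in> R})"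

end

theory Submission
  imports Defs
begin

text \<open>
  Write \<open>x'\<close> for the complement, and \<open>P r\<close> for the pointwise join of \<open>r\<close> over predecessors.
  The adjunction \<open>P r \<le> p \<longleftrightarrow> r \<le> G p\<close> is formal: both sides say \<open>r s \<le> p t\<close> whenever
  \<open>(s, t) \<in> R\<close> (lemma \<open>P_le_iff_le_G\<close>). Since complementation exchanges joins and meets, \<open>P\<close> is
  also the conjugate \<open>x \<mapsto> H(x')'\<close> (lemma \<open>compl_H_compl_eq_P\<close>). The claims about reflexive,
  symmetric and transitive frames follow for \<open>G\<close> by inspection of the meets, and are transported
  to \<open>P\<close> through the adjunction. Everything about \<open>H\<close> and \<open>F\<close> is the same statement for the
  converse frame.

  The content lies in the commutation of \<open>G\<close> and \<open>P\<close> with \<open>q\<close> and \<open>d\<close>. As \<open>G\<close> and \<open>P\<close> are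
  pointwise meets and joins, it suffices that \<open>q\<close> and \<open>d\<close> preserve arbitrary joins and meets of
  \<open>M\<close>, and by \<open>d(x) = q(x')'\<close> it suffices to treat \<open>q\<close>. In a linear q-effect algebra the axioms
  determine \<open>q\<close>: it is \<open>x + x\<close> if \<open>x \<le> x'\<close> (lemma \<open>plus_self_eq_qop\<close>), and \<open>1\<close> if \<open>x' \<le> x\<close>
  (lemma \<open>qop_eq_one\<close>). So the question is whether doubling preserves joins and meets. Addition
  of a fixed element preserves nonempty joins, and in the linear case nonempty meets, because an
  inequality \<open>x + y \<le> b\<close> or \<open>b \<le> x + y\<close> can be solved for \<open>y\<close> by cancellation. Applying this in
  both arguments handles the sums \<open>x + y\<close> with \<open>x, y \<in> X\<close>; and linearity compares such a sum with
  the double of the larger, or of the smaller, of \<open>x\<close> and \<open>y\<close> (lemmas \<open>qop_lub\<close> and \<open>qop_glb\<close>).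
\<close>

section \<open>Arithmetic of effect algebras\<close>

context effect_algebra
begin

lemma compl_props:
  assumes "x \<in> carrier E"
  shows ecompl_closed: "ecompl E x \<in> carrier E"
    and plus_compl: "eplus E x (ecompl E x) = Some (eone E)"
  using theI'[OF E3[OF assms]] unfolding ecompl_def by auto

lemma compl_unique:
  assumes "x \<in> carrier E" "y \<in> carrier E" "eplus E x y = Some (eone E)"
  shows "ecompl E x = y"
  using E3[OF assms(1)] assms compl_props by blast

lemma compl_compl: "x \<in> carrier E \<Longrightarrow> ecompl E (ecompl E x) = x"
  by (rule compl_unique) (auto intro: compl_props E1[OF _ ecompl_closed plus_compl])

lemma compl_one: "ecompl E (eone E) = ezero E"
  using E4[OF ecompl_closed[OF eone_closed]]
    E1[OF eone_closed ecompl_closed plus_compl, OF eone_closed eone_closed] by simp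

lemma compl_zero: "ecompl E (ezero E) = eone E"
  using compl_compl[OF eone_closed] compl_one by simp

text \<open>
  Regrouping \<open>0 + (x + x') = 1\<close> makes \<open>0 + x\<close> a complement of \<open>x'\<close>, and complements are unique.
\<close>

lemma zero_plus:
  assumes x: "x \<in> carrier E"
  shows "eplus E (ezero E) x = Some x"
proof -
  have "eplus E (ezero E) (eone E) = Some (eone E)"
    using plus_compl[OF ezero_closed] compl_zero by simp
  then obtain w where w: "eplus E (ezero E) x = Some w"
      "eplus E w (ecompl E x) = Some (eone E)"
    using E2[OF ezero_closed x ecompl_closed[OF x] plus_compl[OF x]] by blast
  have wc: "w \<in> carrier E"
    using eplus_closed[OF ezero_closed x w(1)] .
  have "w = x"
    using compl_unique[OF ecompl_closed[OF x] wc] E1[OF wc ecompl_closed[OF x] w(2)]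
      compl_compl[OF x] by simp
  with w show ?thesis by simp
qed

lemma plus_zero: "x \<in> carrier E \<Longrightarrow> eplus E x (ezero E) = Some x"
  by (rule E1[OF ezero_closed _ zero_plus])

lemma assoc_right:
  assumes c: "x \<in> carrier E" "y \<in> carrier E" "z \<in> carrier E"
    and xy: "eplus E x y = Some w" and wz: "eplus E w z = Some v"
  obtains u where "eplus E y z = Some u" "eplus E x u = Some v"
proof -
  have w: "w \<in> carrier E" using eplus_closed c xy by blast
  note E1[OF c(1,2) xy] E1[OF w c(3) wz]
  then obtain u where u: "eplus E z y = Some u" "eplus E u x = Some v"
    using E2[of z y x] c by blast
  have "u \<in> carrier E" using eplus_closed c u by blast
  then show thesis using that[of u] E1[OF c(3,2) u(1)] E1[OF _ c(1) u(2)] by blast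
qed

text \<open>
  Both summands become the complement of \<open>v' + x\<close>, where \<open>v\<close> is the common sum.
\<close>

lemma plus_left_cancel:
  assumes c: "x \<in> carrier E" "y \<in> carrier E" "z \<in> carrier E"
    and xy: "eplus E x y = Some v" and xz: "eplus E x z = Some v"
  shows "y = z"
proof -
  have v: "v \<in> carrier E" using eplus_closed c xy by blast
  then have v': "ecompl E v \<in> carrier E" by (rule ecompl_closed)
  have one: "eplus E (ecompl E v) v = Some (eone E)"
    by (rule E1[OF v v' plus_compl[OF v]])
  obtain w where w: "eplus E (ecompl E v) x = Some w" "eplus E w y = Some (eone E)"
    using E2[OF v' c(1,2) xy one] by blast
  have "eplus E w z = Some (eone E)"
    using E2[OF v' c(1,3) xz one] w by auto
  moreover have "w \<in> carrier E" using eplus_closed v' c w by blast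
  ultimately show ?thesis using compl_unique w c by metis
qed

text \<open>
  If \<open>x + y = 0\<close>, regrouping \<open>1 + (x + y)\<close> shows that \<open>1 + x\<close> is defined, which leaves only
  \<open>x = 0\<close>.
\<close>

lemma plus_eq_zero:
  assumes c: "x \<in> carrier E" "y \<in> carrier E" and xy: "eplus E x y = Some (ezero E)"
  shows "x = ezero E"
proof -
  obtain w where w: "eplus E (eone E) x = Some w"
    using E2[OF eone_closed c xy plus_zero[OF eone_closed]] by blast
  then have "eplus E x (eone E) = Some w"
    by (rule E1[OF eone_closed c(1)])
  then show ?thesis using E4[OF c(1)] by simp
qed

lemma le_refl: "x \<in> carrier E \<Longrightarrow> x \<preceq> x"
  unfolding ele_def using plus_zero ezero_closed by blast

lemma le_trans:
  assumes "x \<in> carrier E" "y \<in> carrier E" "z \<in> carrier E" "x \<preceq> y" "y \<preceq> z"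
  shows "x \<preceq> z"
proof -
  obtain a b where a: "a \<in> carrier E" "eplus E x a = Some y"
    and b: "b \<in> carrier E" "eplus E y b = Some z"
    using assms unfolding ele_def by blast
  obtain u where "eplus E a b = Some u" "eplus E x u = Some z"
    using assoc_right assms(1) a b by blast
  then show ?thesis unfolding ele_def using eplus_closed a b by blast
qed

lemma le_antisym:
  assumes "x \<in> carrier E" "y \<in> carrier E" "x \<preceq> y" "y \<preceq> x"
  shows "x = y"
proof -
  obtain a b where a: "a \<in> carrier E" "eplus E x a = Some y"
    and b: "b \<in> carrier E" "eplus E y b = Some x"
    using assms unfolding ele_def by blast
  obtain u where u: "eplus E a b = Some u" "eplus E x u = Some x"
    using assoc_right assms(1) a b by blast
  have "u = ezero E"
    using plus_left_cancel[OF assms(1) _ ezero_closed u(2)] plus_zero assms(1) eplus_closed a b u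
    by blast
  then have "a = ezero E" using plus_eq_zero a b u by blast
  then show ?thesis using a plus_zero assms(1) by simp
qed

lemma zero_le: "x \<in> carrier E \<Longrightarrow> ezero E \<preceq> x"
  unfolding ele_def using zero_plus by blast

lemma le_one: "x \<in> carrier E \<Longrightarrow> x \<preceq> eone E"
  unfolding ele_def using plus_compl ecompl_closed by blast

lemma le_plus: "\<lbrakk>y \<in> carrier E; eplus E x y = Some z\<rbrakk> \<Longrightarrow> x \<preceq> z"
  unfolding ele_def by blast

lemma partial_order_eorder: "partial_order (eorder E)"
  by unfold_locales
    (auto simp: eorder_def intro: le_refl le_antisym intro: le_trans)

lemma compl_antitone:
  assumes "x \<in> carrier E" "y \<in> carrier E" "x \<preceq> y"
  shows "ecompl E y \<preceq> ecompl E x"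
proof -
  obtain z where z: "z \<in> carrier E" "eplus E x z = Some y"
    using assms unfolding ele_def by blast
  obtain u where u: "eplus E z (ecompl E y) = Some u" "eplus E x u = Some (eone E)"
    using assoc_right[OF assms(1) z(1) ecompl_closed[OF assms(2)] z(2) plus_compl[OF assms(2)]]
    by blast
  have "u \<in> carrier E" using eplus_closed z ecompl_closed assms u by blast
  then have "ecompl E x = u" using compl_unique assms u by blast
  moreover have "eplus E (ecompl E y) z = Some u"
    by (rule E1[OF z(1) ecompl_closed[OF assms(2)] u(1)])
  ultimately show ?thesis using le_plus z by blast
qed

lemma compl_le_iff:
  assumes "x \<in> carrier E" "y \<in> carrier E"
  shows "ecompl E x \<preceq> y \<longleftrightarrow> ecompl E y \<preceq> x"
  using assms compl_antitone compl_compl ecompl_closed by metis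

lemma le_compl_iff:
  assumes "x \<in> carrier E" "y \<in> carrier E"
  shows "x \<preceq> ecompl E y \<longleftrightarrow> y \<preceq> ecompl E x"
  using assms compl_antitone compl_compl ecompl_closed by metis

text \<open>
  Order cancellation, stated so that it also transports definedness: with \<open>v = x + b\<close>, an upper
  bound \<open>v\<close> of \<open>x + a\<close> is solved for \<open>a\<close>, and reading it with \<open>a\<close> as the known residual solves
  lower bounds of \<open>x + b\<close>. It replaces a difference operation.
\<close>

lemma plus_le_plus_iff:
  assumes c: "x \<in> carrier E" "a \<in> carrier E" "b \<in> carrier E"
    and v: "eplus E x b = Some v"
  shows "(\<exists>w. eplus E x a = Some w \<and> w \<preceq> v) \<longleftrightarrow> a \<preceq> b"
proof
  assume "\<exists>w. eplus E x a = Some w \<and> w \<preceq> v"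
  then obtain w z where w: "eplus E x a = Some w" "z \<in> carrier E" "eplus E w z = Some v"
    unfolding ele_def by blast
  then obtain u where u: "eplus E a z = Some u" "eplus E x u = Some v"
    using assoc_right c by blast
  then have "u = b"
    using plus_left_cancel[OF c(1) _ c(3) u(2) v] eplus_closed c w by blast
  with u w show "a \<preceq> b" using le_plus by blast
next
  assume "a \<preceq> b"
  then obtain z where "z \<in> carrier E" "eplus E a z = Some b"
    unfolding ele_def by blast
  then show "\<exists>w. eplus E x a = Some w \<and> w \<preceq> v"
    using E2 c v le_plus by blast
qed

lemma plus_defined_iff:
  assumes c: "x \<in> carrier E" "y \<in> carrier E"
  shows "(\<exists>w. eplus E x y = Some w) \<longleftrightarrow> y \<preceq> ecompl E x"
  using plus_le_plus_iff[OF c ecompl_closed plus_compl] c le_one eplus_closed by blast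

end

section \<open>Joins and meets in effect algebras\<close>

context effect_algebra
begin

lemma le_eorder: "le (eorder E) = ele E"
  by (simp add: eorder_def)

lemma carrier_eorder: "carrier (eorder E) = carrier E"
  by (simp add: eorder_def)

text \<open>
  The adjoint forms of suprema and infima: they turn a bound on \<open>j\<close> or \<open>m\<close> directly into bounds
  on the members of \<open>X\<close>, which is how joins and meets enter all later arguments.
\<close>

lemma lub_iff:
  assumes X: "X \<subseteq> carrier E"
  shows "is_lub (eorder E) j X \<longleftrightarrow>
    j \<in> carrier E \<and> (\<forall>b\<in>carrier E. j \<preceq> b \<longleftrightarrow> (\<forall>x\<in>X. x \<preceq> b))"
proof -
  have "is_lub (eorder E) j X \<longleftrightarrow>
      j \<in> carrier E \<and> (\<forall>x\<in>X. x \<preceq> j) \<and> (\<forall>b\<in>carrier E. (\<forall>x\<in>X. x \<preceq> b) \<longrightarrow> j \<preceq> b)"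
    by (auto simp: least_def Upper_def le_eorder carrier_eorder Int_absorb2[OF X])
  also have "\<dots> \<longleftrightarrow> j \<in> carrier E \<and> (\<forall>b\<in>carrier E. j \<preceq> b \<longleftrightarrow> (\<forall>x\<in>X. x \<preceq> b))"
    using X le_refl le_trans by (meson subsetD)
  finally show ?thesis .
qed

lemma glb_iff:
  assumes X: "X \<subseteq> carrier E"
  shows "is_glb (eorder E) m X \<longleftrightarrow>
    m \<in> carrier E \<and> (\<forall>b\<in>carrier E. b \<preceq> m \<longleftrightarrow> (\<forall>x\<in>X. b \<preceq> x))"
proof -
  have "is_glb (eorder E) m X \<longleftrightarrow>
      m \<in> carrier E \<and> (\<forall>x\<in>X. m \<preceq> x) \<and> (\<forall>b\<in>carrier E. (\<forall>x\<in>X. b \<preceq> x) \<longrightarrow> b \<preceq> m)"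
    by (auto simp: greatest_def Lower_def le_eorder carrier_eorder Int_absorb2[OF X])
  also have "\<dots> \<longleftrightarrow> m \<in> carrier E \<and> (\<forall>b\<in>carrier E. b \<preceq> m \<longleftrightarrow> (\<forall>x\<in>X. b \<preceq> x))"
    using X le_refl le_trans by (meson subsetD)
  finally show ?thesis .
qed

lemma lub_unique: "\<lbrakk>is_lub (eorder E) j X; is_lub (eorder E) k X\<rbrakk> \<Longrightarrow> j = k"
  by (rule partial_order.least_unique[OF partial_order_eorder])

lemma glb_unique: "\<lbrakk>is_glb (eorder E) m X; is_glb (eorder E) n X\<rbrakk> \<Longrightarrow> m = n"
  by (rule partial_order.greatest_unique[OF partial_order_eorder])

lemma glb_compl:
  assumes X: "X \<subseteq> carrier E" and j: "is_lub (eorder E) j X"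
  shows "is_glb (eorder E) (ecompl E j) (ecompl E ` X)"
proof -
  have jc: "j \<in> carrier E" and *: "\<And>b. b \<in> carrier E \<Longrightarrow> j \<preceq> b \<longleftrightarrow> (\<forall>x\<in>X. x \<preceq> b)"
    using j lub_iff[OF X] by blast+
  have "b \<preceq> ecompl E j \<longleftrightarrow> (\<forall>x\<in>X. b \<preceq> ecompl E x)" if b: "b \<in> carrier E" for b
    using *[OF ecompl_closed[OF b]] le_compl_iff[OF b] jc X by (metis subsetD)
  moreover have "ecompl E ` X \<subseteq> carrier E"
    using X ecompl_closed by auto
  ultimately show ?thesis using glb_iff jc ecompl_closed by simp
qed

lemma lub_compl:
  assumes X: "X \<subseteq> carrier E" and m: "is_glb (eorder E) m X"
  shows "is_lub (eorder E) (ecompl E m) (ecompl E ` X)"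
proof -
  have mc: "m \<in> carrier E" and *: "\<And>b. b \<in> carrier E \<Longrightarrow> b \<preceq> m \<longleftrightarrow> (\<forall>x\<in>X. b \<preceq> x)"
    using m glb_iff[OF X] by blast+
  have "ecompl E m \<preceq> b \<longleftrightarrow> (\<forall>x\<in>X. ecompl E x \<preceq> b)" if b: "b \<in> carrier E" for b
    using *[OF ecompl_closed[OF b]] compl_le_iff[OF b] compl_le_iff[OF _ b] mc X
    by (metis subsetD)
  moreover have "ecompl E ` X \<subseteq> carrier E"
    using X ecompl_closed by auto
  ultimately show ?thesis using lub_iff mc ecompl_closed by simp
qed

text \<open>
  Solving \<open>x + y \<le> b\<close> for \<open>y\<close> gives \<open>y \<le> c\<close> with \<open>x + c = b\<close>, where \<open>c\<close> is independent of \<open>y\<close>;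
  so \<open>y\<close> can be replaced by the join. A member of \<open>X\<close> is needed to see that \<open>x \<le> b\<close>, that is, that
  \<open>c\<close> exists.
\<close>

lemma plus_lub_le:
  assumes x: "x \<in> carrier E" and b: "b \<in> carrier E"
    and X: "X \<subseteq> carrier E" "X \<noteq> {}" and j: "is_lub (eorder E) j X"
    and le: "\<And>y. y \<in> X \<Longrightarrow> \<exists>w. eplus E x y = Some w \<and> w \<preceq> b"
  shows "\<exists>w. eplus E x j = Some w \<and> w \<preceq> b"
proof -
  have jc: "j \<in> carrier E" and *: "\<And>b. b \<in> carrier E \<Longrightarrow> j \<preceq> b \<longleftrightarrow> (\<forall>x\<in>X. x \<preceq> b)"
    using j lub_iff[OF X(1)] by blast+
  obtain y w where "y \<in> X" "eplus E x y = Some w" "w \<preceq> b"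
    using X(2) le by blast
  then have "x \<preceq> b"
    using le_trans[OF x _ b] eplus_closed[OF x] le_plus X(1) by blast
  then obtain c where c: "c \<in> carrier E" "eplus E x c = Some b"
    unfolding ele_def by blast
  have "y \<preceq> c" if "y \<in> X" for y
    using plus_le_plus_iff[OF x _ c] le[OF that] X that by blast
  then have "j \<preceq> c" using * c by blast
  then show ?thesis using plus_le_plus_iff[OF x jc c] by blast
qed

end

section \<open>Preservation of joins and meets in linear q-effect algebras\<close>

context q_effect_algebra
begin

lemma qop_in: "x \<in> carrier E \<Longrightarrow> qop E x \<in> carrier E"
  using qop_closed by auto

lemma dop_eq: "x \<in> carrier E \<Longrightarrow> dop E x = ecompl E (qop E (ecompl E x))"
  using Q1[OF ecompl_closed] compl_compl by simp

lemma qop_mono: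
  assumes "x \<in> carrier E" "y \<in> carrier E" "x \<preceq> y"
  shows "qop E x \<preceq> qop E y"
proof -
  have "ecompl E (qop E y) \<preceq> ecompl E (qop E x)"
    using Q3[OF ecompl_closed ecompl_closed compl_antitone] Q1 assms by simp
  then show ?thesis
    using compl_le_iff[OF _ ecompl_closed] compl_compl qop_in assms by metis
qed

text \<open>
  The axiom on squares, applied to \<open>x'\<close>: there \<open>x' \<cdot> x' = d(x')\<close> reads \<open>(x + x)' = q(x)'\<close>.
\<close>

lemma plus_self_eq_qop:
  assumes x: "x \<in> carrier E" and le: "x \<preceq> ecompl E x"
  shows "eplus E x x = Some (qop E x)"
proof -
  obtain w where w: "eplus E x x = Some w"
    using plus_defined_iff[OF x x] le by blast
  have "etimes E (ecompl E x) (ecompl E x) = Some (ecompl E w)"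
    using le compl_compl[OF x] w by (simp add: etimes_def)
  moreover have "etimes E (ecompl E x) (ecompl E x) = Some (dop E (ecompl E x))"
    using Q4[OF ecompl_closed[OF x]] le compl_compl[OF x] by simp
  ultimately have "ecompl E w = ecompl E (qop E x)"
    using Q1[OF x] by simp
  then have "w = qop E x"
    using compl_compl[OF qop_in[OF x]] compl_compl[OF eplus_closed[OF x x w]] by simp
  with w show ?thesis by simp
qed

text \<open>
  By (Q5) for \<open>x'\<close> below both \<open>x'\<close> and \<open>x\<close>, \<open>d(x') \<le> x' \<cdot> x = (x + x')' = 0\<close>. Hence
  \<open>q(x)' = 0\<close>.
\<close>

lemma qop_eq_one:
  assumes x: "x \<in> carrier E" and le: "ecompl E x \<preceq> x"
  shows "qop E x = eone E"
proof -
  note x' = ecompl_closed[OF x]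
  have "etimes E (ecompl E x) x = Some (ezero E)"
    using plus_compl[OF x] compl_compl[OF x] le_refl[OF x] compl_one
    by (simp add: etimes_def)
  then have "dop E (ecompl E x) \<preceq> ezero E"
    using Q5[OF x' x x' le_refl[OF x'] le le_refl[OF x']] by simp
  then have "ecompl E (qop E x) = ezero E"
    using Q1[OF x] le_antisym[OF _ ezero_closed] zero_le ecompl_closed[OF qop_in[OF x]] by simp
  then show ?thesis
    using compl_compl[OF qop_in[OF x]] compl_zero by simp
qed

end

locale linear_q_effect_algebra = q_effect_algebra +
  assumes total: "total_order (eorder E)"
begin

lemma le_linear: "\<lbrakk>x \<in> carrier E; y \<in> carrier E\<rbrakk> \<Longrightarrow> x \<preceq> y \<or> y \<preceq> x"
  using total_order.total_order_total[OF total] by (simp add: le_eorder carrier_eorder)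

text \<open>
  The dual of \<open>plus_lub_le\<close>. Here \<open>b \<le> x + y\<close> can be solved for \<open>y\<close> only if \<open>x \<le> b\<close>; linearity
  leaves just the case \<open>b \<le> x\<close>, in which the bound is trivial.
\<close>

lemma le_plus_glb:
  assumes x: "x \<in> carrier E" and b: "b \<in> carrier E"
    and X: "X \<subseteq> carrier E" "X \<noteq> {}" and m: "is_glb (eorder E) m X"
    and le: "\<And>y. y \<in> X \<Longrightarrow> \<exists>w. eplus E x y = Some w \<and> b \<preceq> w"
  shows "\<exists>w. eplus E x m = Some w \<and> b \<preceq> w"
proof -
  have mc: "m \<in> carrier E" and *: "\<And>b. b \<in> carrier E \<Longrightarrow> b \<preceq> m \<longleftrightarrow> (\<forall>x\<in>X. b \<preceq> x)"
    using m glb_iff[OF X(1)] by blast+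
  obtain y v where y: "y \<in> X" "eplus E x y = Some v"
    using X(2) le by blast
  have "m \<preceq> y" using * mc le_refl y by blast
  then obtain w where w: "eplus E x m = Some w"
    using plus_le_plus_iff[OF x mc _ y(2)] y X by blast
  have wc: "w \<in> carrier E" using eplus_closed[OF x mc w] .
  have "b \<preceq> w"
  proof (cases "b \<preceq> x")
    case True
    then show ?thesis using le_trans[OF b x wc] le_plus[OF mc w] by blast
  next
    case False
    then have "x \<preceq> b" using le_linear x b by blast
    then obtain c where c: "c \<in> carrier E" "eplus E x c = Some b"
      unfolding ele_def by blast
    have "c \<preceq> y" if yX: "y \<in> X" for y
    proof -
      obtain v where v: "eplus E x y = Some v" "b \<preceq> v" using le[OF yX] by blast
      then show ?thesis using plus_le_plus_iff[OF x c(1) _ v(1)] c(2) X yX by blast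
    qed
    then have "c \<preceq> m" using * c by blast
    then show ?thesis using plus_le_plus_iff[OF x c(1) mc w] c(2) by simp
  qed
  with w show ?thesis by blast
qed

text \<open>
  For empty \<open>X\<close> this is \<open>q(0) = 0\<close>. If some member of \<open>X\<close> lies above its complement, then \<open>q\<close>
  is \<open>1\<close> there and at the join. Otherwise \<open>q\<close> is doubling on \<open>X\<close>, and for \<open>x \<le> y\<close> in \<open>X\<close> the sum \<open>x + y\<close> is at most \<open>y + y\<close>.
  So every upper bound \<open>b\<close> of the doubles bounds all sums of two members of \<open>X\<close>; passing to the
  join \<open>j\<close> in one summand and then in the other gives \<open>j + j \<le> b\<close>, and in particular that
  \<open>j + j\<close> is defined.
\<close>

lemma qop_lub:
  assumes X: "X \<subseteq> carrier E" and j: "is_lub (eorder E) j X"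
  shows "is_lub (eorder E) (qop E j) (qop E ` X)"
proof -
  have jc: "j \<in> carrier E" and *: "\<And>b. b \<in> carrier E \<Longrightarrow> j \<preceq> b \<longleftrightarrow> (\<forall>x\<in>X. x \<preceq> b)"
    using j lub_iff[OF X] by blast+
  have upper: "qop E x \<preceq> qop E j" if "x \<in> X" for x
    using qop_mono[of x j] * jc le_refl X that by blast
  have least: "qop E j \<preceq> b" if b: "b \<in> carrier E" and bX: "\<forall>x\<in>X. qop E x \<preceq> b" for b
  proof -
    consider "X = {}" | x where "x \<in> X" "ecompl E x \<preceq> x"
      | "X \<noteq> {}" "\<And>x. x \<in> X \<Longrightarrow> x \<preceq> ecompl E x"
      using le_linear X ecompl_closed by blast
    then show ?thesis
    proof cases
      case 1
      then have "j \<preceq> ezero E" using * ezero_closed by simp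
      then have "j = ezero E" using le_antisym jc ezero_closed zero_le by blast
      then show ?thesis using Q2 zero_le b by simp
    next
      case 2
      then have "eone E \<preceq> b" using bX qop_eq_one X by force
      then have "b = eone E" using le_antisym b eone_closed le_one by blast
      then show ?thesis using le_one qop_in jc by simp
    next
      case 3
      have pair: "\<exists>w. eplus E x y = Some w \<and> w \<preceq> b"
        if xy: "x \<in> X" "y \<in> X" "x \<preceq> y" for x y
      proof -
        have c: "x \<in> carrier E" "y \<in> carrier E" using xy X by auto
        have yy: "eplus E y y = Some (qop E y)"
          using plus_self_eq_qop c 3 xy by blast
        then obtain w where w: "eplus E y x = Some w" "w \<preceq> qop E y"
          using plus_le_plus_iff[OF c(2,1,2) yy] xy by blast
        have "w \<preceq> b"
          using le_trans[OF eplus_closed[OF c(2,1) w(1)] qop_in[OF c(2)] b w(2)] bX xy by blast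
        then show ?thesis using E1[OF c(2,1) w(1)] by blast
      qed
      have pair': "\<exists>w. eplus E x y = Some w \<and> w \<preceq> b" if xy: "x \<in> X" "y \<in> X" for x y
      proof (cases "x \<preceq> y")
        case True
        then show ?thesis using pair xy by blast
      next
        case False
        then obtain w where "eplus E y x = Some w" "w \<preceq> b"
          using pair le_linear xy X by blast
        then show ?thesis using E1[of y x w] xy X by blast
      qed
      have "\<exists>w. eplus E x j = Some w \<and> w \<preceq> b" if "x \<in> X" for x
        using plus_lub_le[OF _ b X 3(1) j, of x] pair' that X by blast
      then have "\<exists>w. eplus E j x = Some w \<and> w \<preceq> b" if "x \<in> X" for x
        using E1[of x j] that X jc by blast
      then obtain w where w: "eplus E j j = Some w" "w \<preceq> b"
        using plus_lub_le[OF jc b X 3(1) j] by blast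
      then have "qop E j = w"
        using plus_self_eq_qop[OF jc] plus_defined_iff[OF jc jc] by simp
      with w show ?thesis by simp
    qed
  qed
  have "qop E j \<preceq> b \<longleftrightarrow> (\<forall>x\<in>X. qop E x \<preceq> b)" if b: "b \<in> carrier E" for b
    using least[OF b] upper le_trans[OF _ _ b] qop_in jc X by (meson subsetD)
  moreover have "qop E ` X \<subseteq> carrier E" using qop_in X by auto
  ultimately show ?thesis using lub_iff qop_in jc by simp
qed

text \<open>
  If \<open>m' \<le> m\<close>, then \<open>q(m) = 1\<close>. Otherwise some member \<open>z\<close> of \<open>X\<close> satisfies \<open>z \<le> z'\<close>, and the
  meet is unchanged when \<open>X\<close> is cut down to the members below \<open>z\<close>. On these \<open>q\<close> is doubling, and
  \<open>x + y \<ge> x + x\<close> for \<open>x \<le> y\<close>; the argument for joins then applies with the inequalities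
  reversed.
\<close>

lemma qop_glb:
  assumes X: "X \<subseteq> carrier E" and m: "is_glb (eorder E) m X"
  shows "is_glb (eorder E) (qop E m) (qop E ` X)"
proof -
  have mc: "m \<in> carrier E" and *: "\<And>b. b \<in> carrier E \<Longrightarrow> b \<preceq> m \<longleftrightarrow> (\<forall>x\<in>X. b \<preceq> x)"
    using m glb_iff[OF X] by blast+
  note m' = ecompl_closed[OF mc]
  have lower: "qop E m \<preceq> qop E x" if "x \<in> X" for x
    using qop_mono[of m x] * mc le_refl X that by blast
  have greatest: "b \<preceq> qop E m" if b: "b \<in> carrier E" and bX: "\<forall>x\<in>X. b \<preceq> qop E x" for b
  proof (cases "ecompl E m \<preceq> m")
    case True
    then show ?thesis using qop_eq_one mc le_one b by simp
  next
    case False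
    then have mm: "m \<preceq> ecompl E m" using le_linear mc m' by blast
    (* If x' \<le> y held for all x, y in X, passing to the meet twice would give m' \<le> m; so it
       fails for some pair, and the smaller element of the pair serves as z. *)
    obtain x0 where x0: "x0 \<in> X" "\<not> ecompl E m \<preceq> x0"
      using False * m' by blast
    then obtain x1 where x1: "x1 \<in> X" "\<not> ecompl E x0 \<preceq> x1"
      using * compl_le_iff[OF mc] ecompl_closed X by (metis subsetD)
    define z where "z = (if x0 \<preceq> x1 then x0 else x1)"
    have c01: "x0 \<in> carrier E" "x1 \<in> carrier E" using x0 x1 X by auto
    have z: "z \<in> X" "z \<preceq> x0" "z \<preceq> x1"
      using x0 x1 c01 le_linear le_refl by (auto simp: z_def)
    then have zc: "z \<in> carrier E" using X by blast
    have "z \<preceq> ecompl E z"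
    proof -
      have "x1 \<preceq> ecompl E x0" using le_linear x1 c01 ecompl_closed by blast
      moreover have "ecompl E x0 \<preceq> ecompl E z" using compl_antitone z zc c01 by blast
      ultimately show ?thesis using le_trans z zc c01 ecompl_closed by meson
    qed
    define Y where "Y = {y \<in> X. y \<preceq> z}"
    have Y: "Y \<subseteq> carrier E" "Y \<noteq> {}" using X z zc le_refl by (auto simp: Y_def)
    have "(\<forall>y\<in>Y. a \<preceq> y) \<longleftrightarrow> (\<forall>x\<in>X. a \<preceq> x)" if a: "a \<in> carrier E" for a
    proof
      assume *: "\<forall>y\<in>Y. a \<preceq> y"
      show "\<forall>x\<in>X. a \<preceq> x"
      proof
        fix x assume x: "x \<in> X"
        then have xc: "x \<in> carrier E" using X by blast
        have "a \<preceq> z" using * z zc le_refl by (simp add: Y_def)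
        then show "a \<preceq> x"
          using * x le_linear[OF xc zc] le_trans[OF a zc xc] by (auto simp: Y_def)
      qed
    qed (simp add: Y_def)
    then have mY: "is_glb (eorder E) m Y"
      using * mc by (simp add: glb_iff[OF Y(1)])
    have small: "y \<preceq> ecompl E y" if "y \<in> Y" for y
    proof -
      have yc: "y \<in> carrier E" and yz: "y \<preceq> z" using that X by (auto simp: Y_def)
      have "y \<preceq> ecompl E z" using le_trans yc zc ecompl_closed yz \<open>z \<preceq> ecompl E z\<close> by blast
      moreover have "ecompl E z \<preceq> ecompl E y" using compl_antitone yc zc yz by blast
      ultimately show ?thesis using le_trans yc zc ecompl_closed by meson
    qed
    have pair: "\<exists>w. eplus E x y = Some w \<and> b \<preceq> w"
      if xy: "x \<in> Y" "y \<in> Y" "x \<preceq> y" for x y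
    proof -
      have c: "x \<in> carrier E" "y \<in> carrier E" using xy Y by auto
      have xx: "eplus E x x = Some (qop E x)"
        using plus_self_eq_qop c small xy by blast
      have "x \<preceq> ecompl E y"
        using le_trans[OF c ecompl_closed[OF c(2)]] small xy by blast
      then have "y \<preceq> ecompl E x" using le_compl_iff c by blast
      then obtain w where w: "eplus E x y = Some w"
        using plus_defined_iff[OF c] by blast
      have "qop E x \<preceq> w"
        using plus_le_plus_iff[OF c(1,1,2) w] xx xy by simp
      then have "b \<preceq> w"
        using le_trans[OF b qop_in[OF c(1)] eplus_closed[OF c w]] bX xy by (auto simp: Y_def)
      with w show ?thesis by blast
    qed
    have pair': "\<exists>w. eplus E x y = Some w \<and> b \<preceq> w" if xy: "x \<in> Y" "y \<in> Y" for x y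
    proof (cases "x \<preceq> y")
      case True
      then show ?thesis using pair xy by blast
    next
      case False
      then obtain w where "eplus E y x = Some w" "b \<preceq> w"
        using pair le_linear xy Y by blast
      then show ?thesis using E1[of y x w] xy Y by blast
    qed
    have "\<exists>w. eplus E x m = Some w \<and> b \<preceq> w" if "x \<in> Y" for x
      using le_plus_glb[OF _ b Y mY, of x] pair' that Y by blast
    then have "\<exists>w. eplus E m x = Some w \<and> b \<preceq> w" if "x \<in> Y" for x
      using E1[of x m] that Y mc by blast
    then obtain w where w: "eplus E m m = Some w" "b \<preceq> w"
      using le_plus_glb[OF mc b Y mY] by blast
    then show ?thesis using plus_self_eq_qop[OF mc mm] by simp
  qed
  have "b \<preceq> qop E m \<longleftrightarrow> (\<forall>x\<in>X. b \<preceq> qop E x)" if b: "b \<in> carrier E" for b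
    using greatest[OF b] lower le_trans[OF b] qop_in mc X by (meson subsetD)
  moreover have "qop E ` X \<subseteq> carrier E" using qop_in X by auto
  ultimately show ?thesis using glb_iff qop_in mc by simp
qed

text \<open>
  Joins and meets under \<open>d\<close> are obtained from those under \<open>q\<close> by two complementations, each of
  which exchanges joins and meets.
\<close>

lemma dop_image:
  "X \<subseteq> carrier E \<Longrightarrow> dop E ` X = ecompl E ` qop E ` ecompl E ` X"
  using dop_eq unfolding image_image by (intro image_cong) auto

lemma dop_lub:
  assumes X: "X \<subseteq> carrier E" and j: "is_lub (eorder E) j X"
  shows "is_lub (eorder E) (dop E j) (dop E ` X)"
proof -
  have c: "ecompl E ` X \<subseteq> carrier E" "qop E ` ecompl E ` X \<subseteq> carrier E" "j \<in> carrier E"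
    using X ecompl_closed qop_in j lub_iff[OF X] by auto
  show ?thesis
    unfolding dop_image[OF X] dop_eq[OF c(3)]
    by (intro lub_compl qop_glb glb_compl c X j)
qed

lemma dop_glb:
  assumes X: "X \<subseteq> carrier E" and m: "is_glb (eorder E) m X"
  shows "is_glb (eorder E) (dop E m) (dop E ` X)"
proof -
  have c: "ecompl E ` X \<subseteq> carrier E" "qop E ` ecompl E ` X \<subseteq> carrier E" "m \<in> carrier E"
    using X ecompl_closed qop_in m glb_iff[OF X] by auto
  show ?thesis
    unfolding dop_image[OF X] dop_eq[OF c(3)]
    by (intro glb_compl qop_lub lub_compl c X m)
qed

end

section \<open>Direct powers\<close>

locale q_effect_algebra_power = q_effect_algebra M
  for M :: "'a q_effect_struct" +
  fixes S :: "'s set"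
  assumes S_nonempty: "S \<noteq> {}"
begin

abbreviation MS :: "('s \<Rightarrow> 'a) q_effect_struct"
  where "MS \<equiv> q_effect_power M S"

lemma power_sel:
  "carrier MS = S \<rightarrow>\<^sub>E carrier M"
  "ezero MS = (\<lambda>s\<in>S. ezero M)"
  "eone MS = (\<lambda>s\<in>S. eone M)"
  "qop MS f = (\<lambda>s\<in>S. qop M (f s))"
  "dop MS f = (\<lambda>s\<in>S. dop M (f s))"
  by (simp_all add: q_effect_power_def)

lemma power_memD: "\<lbrakk>f \<in> carrier MS; s \<in> S\<rbrakk> \<Longrightarrow> f s \<in> carrier M"
  by (auto simp: power_sel)

lemma power_memI: "(\<And>s. s \<in> S \<Longrightarrow> f s \<in> carrier M) \<Longrightarrow> (\<lambda>s\<in>S. f s) \<in> carrier MS"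
  by (auto simp: power_sel)

lemma power_eqI: "\<lbrakk>f \<in> carrier MS; g \<in> carrier MS; \<And>s. s \<in> S \<Longrightarrow> f s = g s\<rbrakk> \<Longrightarrow> f = g"
  unfolding power_sel by (rule PiE_ext)

lemma plus_power_iff:
  "eplus MS f g = Some h \<longleftrightarrow>
    h \<in> extensional S \<and> (\<forall>s\<in>S. eplus M (f s) (g s) = Some (h s))"
proof
  assume "eplus MS f g = Some h"
  then show "h \<in> extensional S \<and> (\<forall>s\<in>S. eplus M (f s) (g s) = Some (h s))"
    by (auto simp: q_effect_power_def split: if_splits)
next
  assume h: "h \<in> extensional S \<and> (\<forall>s\<in>S. eplus M (f s) (g s) = Some (h s))"
  then have "(\<lambda>s\<in>S. the (eplus M (f s) (g s))) = h"
    by (intro extensionalityI[of _ S]) auto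
  with h show "eplus MS f g = Some h"
    by (simp add: q_effect_power_def)
qed

lemma plus_power_closed:
  assumes "f \<in> carrier MS" "g \<in> carrier MS" "eplus MS f g = Some h"
  shows "h \<in> carrier MS"
proof -
  have "h s \<in> carrier M" if "s \<in> S" for s
    using eplus_closed[OF power_memD[OF assms(1) that] power_memD[OF assms(2) that]] assms(3) that
    by (simp add: plus_power_iff)
  then show ?thesis using assms(3) by (simp add: plus_power_iff power_sel(1) PiE_iff)
qed

lemma plus_power_eq_one_iff:
  assumes "f \<in> carrier MS" "g \<in> carrier MS"
  shows "eplus MS f g = Some (eone MS) \<longleftrightarrow> g = (\<lambda>s\<in>S. ecompl M (f s))"
proof
  assume "eplus MS f g = Some (eone MS)"
  then have "ecompl M (f s) = g s" if "s \<in> S" for s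
    using compl_unique power_memD assms that by (simp add: plus_power_iff power_sel(3))
  then show "g = (\<lambda>s\<in>S. ecompl M (f s))"
    using assms power_memI ecompl_closed power_memD by (intro power_eqI) auto
next
  assume "g = (\<lambda>s\<in>S. ecompl M (f s))"
  then show "eplus MS f g = Some (eone MS)"
    using plus_compl power_memD[OF assms(1)] by (simp add: plus_power_iff power_sel(3))
qed

sublocale power: effect_algebra MS
proof
  show "ezero MS \<in> carrier MS" "eone MS \<in> carrier MS"
    using ezero_closed eone_closed by (simp_all add: power_sel)
  show "ezero MS \<noteq> eone MS"
    using S_nonempty ezero_neq_eone by (auto simp: power_sel restrict_def fun_eq_iff)
next
  fix x y z assume "x \<in> carrier MS" "y \<in> carrier MS" "eplus MS x y = Some z"
  then show "z \<in> carrier MS" by (rule plus_power_closed)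
next
  fix x y z assume c: "x \<in> carrier MS" "y \<in> carrier MS" and xy: "eplus MS x y = Some z"
  have "eplus M (y s) (x s) = Some (z s)" if s: "s \<in> S" for s
    by (rule E1[OF power_memD[OF c(1) s] power_memD[OF c(2) s]])
      (use xy s in \<open>simp add: plus_power_iff\<close>)
  then show "eplus MS y x = Some z"
    using xy by (simp add: plus_power_iff)
next
  fix x y z u v
  assume c: "x \<in> carrier MS" "y \<in> carrier MS" "z \<in> carrier MS"
    and "eplus MS y z = Some u" "eplus MS x u = Some v"
  then have uv: "v \<in> extensional S"
    "\<And>s. s \<in> S \<Longrightarrow> eplus M (y s) (z s) = Some (u s)"
    "\<And>s. s \<in> S \<Longrightarrow> eplus M (x s) (u s) = Some (v s)"
    by (auto simp: plus_power_iff)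
  have "\<forall>s\<in>S. \<exists>w. eplus M (x s) (y s) = Some w \<and> eplus M w (z s) = Some (v s)"
  proof
    fix s assume s: "s \<in> S"
    show "\<exists>w. eplus M (x s) (y s) = Some w \<and> eplus M w (z s) = Some (v s)"
      by (rule E2[OF power_memD[OF c(1) s] power_memD[OF c(2) s] power_memD[OF c(3) s]
            uv(2)[OF s] uv(3)[OF s]])
  qed
  then obtain w where
    w: "\<forall>s\<in>S. eplus M (x s) (y s) = Some (w s) \<and> eplus M (w s) (z s) = Some (v s)"
    by metis
  then have "eplus MS x y = Some (restrict w S) \<and> eplus MS (restrict w S) z = Some v"
    using uv(1) by (simp add: plus_power_iff)
  then show "\<exists>w. eplus MS x y = Some w \<and> eplus MS w z = Some v" by blast
next
  fix x assume x: "x \<in> carrier MS"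
  moreover have "(\<lambda>s\<in>S. ecompl M (x s)) \<in> carrier MS"
    using ecompl_closed power_memD[OF x] by (intro power_memI) blast
  ultimately show "\<exists>!y. y \<in> carrier MS \<and> eplus MS x y = Some (eone MS)"
    using plus_power_eq_one_iff by blast
next
  fix x assume x: "x \<in> carrier MS" and "eplus MS x (eone MS) \<noteq> None"
  then obtain h where "eplus MS x (eone MS) = Some h" by blast
  then have "x s = ezero M" if "s \<in> S" for s
    using E4[OF power_memD[OF x that]] that by (simp add: plus_power_iff power_sel(3))
  then show "x = ezero MS"
    using x ezero_closed by (intro power_eqI) (auto simp: power_sel)
qed

lemma compl_power:
  assumes f: "f \<in> carrier MS"
  shows "ecompl MS f = (\<lambda>s\<in>S. ecompl M (f s))"
  using plus_power_eq_one_iff[OF f power.ecompl_closed[OF f]] power.plus_compl[OF f] by simp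

lemma le_power_iff:
  assumes f: "f \<in> carrier MS" and g: "g \<in> carrier MS"
  shows "f \<preceq>\<^bsub>MS\<^esub> g \<longleftrightarrow> (\<forall>s\<in>S. f s \<preceq>\<^bsub>M\<^esub> g s)"
proof
  assume "f \<preceq>\<^bsub>MS\<^esub> g"
  then show "\<forall>s\<in>S. f s \<preceq>\<^bsub>M\<^esub> g s"
    using power_memD unfolding ele_def plus_power_iff by blast
next
  assume "\<forall>s\<in>S. f s \<preceq>\<^bsub>M\<^esub> g s"
  then obtain h where h: "\<forall>s\<in>S. h s \<in> carrier M \<and> eplus M (f s) (h s) = Some (g s)"
    unfolding ele_def by metis
  then have "eplus MS f (restrict h S) = Some g"
    using g by (auto simp: plus_power_iff power_sel(1) PiE_def)
  moreover have "restrict h S \<in> carrier MS" using h by (intro power_memI) auto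
  ultimately show "f \<preceq>\<^bsub>MS\<^esub> g" unfolding ele_def by blast
qed

lemma compl_le_power_iff:
  assumes f: "f \<in> carrier MS" and g: "g \<in> carrier MS"
  shows "ecompl MS f \<preceq>\<^bsub>MS\<^esub> g \<longleftrightarrow> (\<forall>s\<in>S. ecompl M (f s) \<preceq>\<^bsub>M\<^esub> g s)"
  using le_power_iff[OF power.ecompl_closed[OF f] g] by (simp add: compl_power[OF f])

lemma times_power:
  assumes f: "f \<in> carrier MS" and g: "g \<in> carrier MS" and h: "h \<in> extensional S"
    and fg: "\<And>s. s \<in> S \<Longrightarrow> etimes M (f s) (g s) = Some (h s)"
  shows "etimes MS f g = Some h"
proof -
  note f' = power.ecompl_closed[OF f] and g' = power.ecompl_closed[OF g]
  have le: "ecompl M (f s) \<preceq>\<^bsub>M\<^esub> g s"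
    and hs: "h s = ecompl M (the (eplus M (ecompl M (f s)) (ecompl M (g s))))"
    if "s \<in> S" for s
    using fg[OF that] by (auto simp: etimes_def split: if_splits)
  have le': "ecompl MS f \<preceq>\<^bsub>MS\<^esub> g"
    using le by (simp add: compl_le_power_iff[OF f g])
  then have "ecompl MS g \<preceq>\<^bsub>MS\<^esub> ecompl MS (ecompl MS f)"
    using power.compl_antitone f' g by blast
  then obtain k where k: "eplus MS (ecompl MS f) (ecompl MS g) = Some k"
    using power.plus_defined_iff[OF f' g'] by blast
  have kc: "k \<in> carrier MS" using power.eplus_closed[OF f' g' k] .
  have "ecompl MS k = h"
  proof (rule extensionalityI[of _ S])
    show "ecompl MS k \<in> extensional S"
      by (simp add: compl_power[OF kc])
    fix s assume s: "s \<in> S"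
    then have "eplus M (ecompl M (f s)) (ecompl M (g s)) = Some (k s)"
      using k f g by (simp add: plus_power_iff compl_power)
    then show "ecompl MS k s = h s"
      using hs[OF s] s by (simp add: compl_power[OF kc])
  qed (rule h)
  then show ?thesis using le' k by (simp add: etimes_def)
qed

sublocale power: q_effect_algebra MS
proof
  show "qop MS \<in> carrier MS \<rightarrow> carrier MS" "dop MS \<in> carrier MS \<rightarrow> carrier MS"
    using qop_closed dop_closed by (auto simp: power_sel)
  fix x assume x: "x \<in> carrier MS"
  have qx: "qop MS x \<in> carrier MS"
    using qop_closed x by (auto simp: power_sel)
  show "dop MS (ecompl MS x) = ecompl MS (qop MS x)"
    using Q1[OF power_memD[OF x]]
    by (simp add: compl_power x qx) (simp add: power_sel cong: restrict_cong)
next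
  show "dop MS (ezero MS) = ezero MS" "qop MS (ezero MS) = ezero MS"
    using Q2 by (simp_all add: power_sel cong: restrict_cong)
next
  fix x y assume c: "x \<in> carrier MS" "y \<in> carrier MS" and "x \<preceq>\<^bsub>MS\<^esub> y"
  then have "dop M (x s) \<preceq>\<^bsub>M\<^esub> dop M (y s)" if "s \<in> S" for s
    using Q3 power_memD that by (simp add: le_power_iff)
  moreover have "dop MS x \<in> carrier MS" "dop MS y \<in> carrier MS"
    using dop_closed c by (auto simp: power_sel)
  ultimately show "dop MS x \<preceq>\<^bsub>MS\<^esub> dop MS y"
    by (simp add: le_power_iff power_sel(5))
next
  fix x assume x: "x \<in> carrier MS" and le: "ecompl MS x \<preceq>\<^bsub>MS\<^esub> x"
  have "etimes M (x s) (x s) = Some (dop MS x s)" if "s \<in> S" for s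
    using Q4[OF power_memD[OF x that]] le that
    by (simp add: compl_le_power_iff[OF x x] power_sel(5))
  then show "etimes MS x x = Some (dop MS x)"
    by (intro times_power[OF x x]) (auto simp: power_sel(5))
next
  fix x y z
  assume c: "x \<in> carrier MS" "y \<in> carrier MS" "z \<in> carrier MS"
    and le: "z \<preceq>\<^bsub>MS\<^esub> x" "z \<preceq>\<^bsub>MS\<^esub> y" "ecompl MS y \<preceq>\<^bsub>MS\<^esub> x"
  have "\<exists>w. etimes M (x s) (y s) = Some w \<and> dop M (z s) \<preceq>\<^bsub>M\<^esub> w" if s: "s \<in> S" for s
  proof (rule Q5)
    show "ecompl M (y s) \<preceq>\<^bsub>M\<^esub> x s"
      using le(3) s by (simp add: compl_le_power_iff[OF c(2,1)])
  qed (use c le s power_memD le_power_iff in blast)+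
  then obtain w where
    w: "\<And>s. s \<in> S \<Longrightarrow> etimes M (x s) (y s) = Some (w s) \<and> dop M (z s) \<preceq>\<^bsub>M\<^esub> w s"
    by metis
  have xy: "etimes MS x y = Some (restrict w S)"
    using w by (intro times_power[OF c(1,2)]) auto
  have "w s \<in> carrier M" if s: "s \<in> S" for s
  proof -
    note cs = power_memD[OF c(1) s] power_memD[OF c(2) s]
    have le_s: "ecompl M (x s) \<preceq>\<^bsub>M\<^esub> y s"
      and ws: "w s = ecompl M (the (eplus M (ecompl M (x s)) (ecompl M (y s))))"
      using w[OF s] by (auto simp: etimes_def split: if_splits)
    have "ecompl M (y s) \<preceq>\<^bsub>M\<^esub> ecompl M (ecompl M (x s))"
      using compl_antitone[OF ecompl_closed[OF cs(1)] cs(2) le_s] .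
    then obtain k where k: "eplus M (ecompl M (x s)) (ecompl M (y s)) = Some k"
      using plus_defined_iff[OF ecompl_closed[OF cs(1)] ecompl_closed[OF cs(2)]] by blast
    have "k \<in> carrier M" using eplus_closed[OF _ _ k] ecompl_closed cs by blast
    then show ?thesis using ws k ecompl_closed by simp
  qed
  then have "restrict w S \<in> carrier MS" by (rule power_memI)
  moreover have "dop MS z \<in> carrier MS"
    using dop_closed c by (auto simp: power_sel)
  ultimately have "dop MS z \<preceq>\<^bsub>MS\<^esub> restrict w S"
    using w by (simp add: le_power_iff power_sel(5))
  with xy show "\<exists>w. etimes MS x y = Some w \<and> dop MS z \<preceq>\<^bsub>MS\<^esub> w" by blast
qed

end

section \<open>The operators of a time frame\<close>

context effect_algebra
begin

lemma left_adjoint_iff: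
  "left_adjoint E f g \<longleftrightarrow>
    f \<in> carrier E \<rightarrow> carrier E \<and> g \<in> carrier E \<rightarrow> carrier E \<and>
    (\<forall>x\<in>carrier E. \<forall>y\<in>carrier E. f x \<preceq> y \<longleftrightarrow> x \<preceq> g y)"
  using partial_order_eorder
  by (auto simp: left_adjoint_def galois_connection_def connection_def
      galois_connection_axioms_def le_eorder carrier_eorder)

lemma left_adjoint_unique:
  assumes "left_adjoint E f g" "left_adjoint E f' g" "x \<in> carrier E"
  shows "f x = f' x"
proof -
  have c: "f x \<in> carrier E" "f' x \<in> carrier E"
    using assms by (auto simp: left_adjoint_iff)
  have "f x \<preceq> y \<longleftrightarrow> f' x \<preceq> y" if "y \<in> carrier E" for y
    using assms that by (simp add: left_adjoint_iff)
  then show ?thesis using le_antisym c le_refl by blast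
qed

end

text \<open>
  Past is future for the converse relation: results on \<open>G\<close> and \<open>P\<close> for all frames thereby cover
  \<open>H\<close> and \<open>F\<close>.
\<close>

lemma H_star_eq_G_star_converse: "H_star M S R = G_star M S (R\<inverse>)"
  by (simp add: fun_eq_iff G_star_def H_star_def)

text \<open>
  This is \<open>P\<^sup>*\<close>; \<open>F\<^sup>*\<close> is \<open>join_star M S (R\<inverse>)\<close>.
\<close>

definition join_star :: "'a q_effect_struct \<Rightarrow> 's set \<Rightarrow> ('s \<times> 's) set \<Rightarrow> ('s \<Rightarrow> 'a) \<Rightarrow> 's \<Rightarrow> 'a"
  where "join_star M S R r = (\<lambda>t\<in>S. \<Squnion>\<^bsub>eorder M\<^esub>{r s | s. s \<in> S \<and> (s, t) \<in> R})"

locale complete_linear_time_frame =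
  linear_q_effect_algebra M + q_effect_algebra_power M S
  for M :: "'a q_effect_struct" and S :: "'s set" +
  fixes R :: "('s \<times> 's) set"
  assumes complete: "complete_lattice (eorder M)"
    and R_subset: "R \<subseteq> S \<times> S"
begin

abbreviation "G \<equiv> G_star M S R"
abbreviation "P \<equiv> join_star M S R"

lemma is_glb_G:
  assumes p: "p \<in> carrier MS" and s: "s \<in> S"
  shows "is_glb (eorder M) (G p s) (p ` (R `` {s}))"
proof -
  interpret L: complete_lattice "eorder M" by (rule complete)
  have "{p t | t. t \<in> S \<and> (s, t) \<in> R} = p ` (R `` {s})"
    using R_subset by auto
  moreover have "p ` (R `` {s}) \<subseteq> carrier (eorder M)"
    using R_subset power_memD[OF p] by (auto simp: carrier_eorder)
  ultimately show ?thesis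
    using L.inf_glb s by (simp add: G_star_def)
qed

lemma is_lub_P:
  assumes r: "r \<in> carrier MS" and t: "t \<in> S"
  shows "is_lub (eorder M) (P r t) (r ` (R\<inverse> `` {t}))"
proof -
  interpret L: complete_lattice "eorder M" by (rule complete)
  have "{r s | s. s \<in> S \<and> (s, t) \<in> R} = r ` (R\<inverse> `` {t})"
    using R_subset by auto
  moreover have "r ` (R\<inverse> `` {t}) \<subseteq> carrier (eorder M)"
    using R_subset power_memD[OF r] by (auto simp: carrier_eorder)
  ultimately show ?thesis
    using L.sup_lub t by (simp add: join_star_def)
qed

lemma image_closed:
  assumes "p \<in> carrier MS"
  shows "p ` (R `` {s}) \<subseteq> carrier M" "p ` (R\<inverse> `` {s}) \<subseteq> carrier M"
  using R_subset power_memD[OF assms] by auto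

lemma G_closed:
  assumes p: "p \<in> carrier MS"
  shows "G p \<in> carrier MS"
proof -
  have "G p s \<in> carrier M" if "s \<in> S" for s
    using is_glb_G[OF p that] glb_iff[OF image_closed(1)[OF p]] by blast
  then show ?thesis by (auto simp: power_sel(1) G_star_def)
qed

lemma P_closed:
  assumes r: "r \<in> carrier MS"
  shows "P r \<in> carrier MS"
proof -
  have "P r t \<in> carrier M" if "t \<in> S" for t
    using is_lub_P[OF r that] lub_iff[OF image_closed(2)[OF r]] by blast
  then show ?thesis by (auto simp: power_sel(1) join_star_def)
qed

lemma le_G_iff:
  assumes p: "p \<in> carrier MS" and s: "s \<in> S" and b: "b \<in> carrier M"
  shows "b \<preceq>\<^bsub>M\<^esub> G p s \<longleftrightarrow> (\<forall>t. (s, t) \<in> R \<longrightarrow> b \<preceq>\<^bsub>M\<^esub> p t)"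
  using is_glb_G[OF p s] b by (auto simp: glb_iff[OF image_closed(1)[OF p]])

lemma P_le_iff:
  assumes r: "r \<in> carrier MS" and t: "t \<in> S" and b: "b \<in> carrier M"
  shows "P r t \<preceq>\<^bsub>M\<^esub> b \<longleftrightarrow> (\<forall>s. (s, t) \<in> R \<longrightarrow> r s \<preceq>\<^bsub>M\<^esub> b)"
  using is_lub_P[OF r t] b by (auto simp: lub_iff[OF image_closed(2)[OF r]])

text \<open>
  Both sides assert \<open>r s \<le> p t\<close> for all \<open>(s, t) \<in> R\<close>; the left one collects these inequalities
  by \<open>t\<close>, the right one by \<open>s\<close>.
\<close>

lemma P_le_iff_le_G:
  assumes r: "r \<in> carrier MS" and p: "p \<in> carrier MS"
  shows "P r \<preceq>\<^bsub>MS\<^esub> p \<longleftrightarrow> r \<preceq>\<^bsub>MS\<^esub> G p"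
proof -
  have "P r \<preceq>\<^bsub>MS\<^esub> p \<longleftrightarrow> (\<forall>t\<in>S. \<forall>s. (s, t) \<in> R \<longrightarrow> r s \<preceq>\<^bsub>M\<^esub> p t)"
    using P_le_iff[OF r _ power_memD[OF p]] by (simp add: le_power_iff P_closed r p)
  also have "\<dots> \<longleftrightarrow> (\<forall>s\<in>S. \<forall>t. (s, t) \<in> R \<longrightarrow> r s \<preceq>\<^bsub>M\<^esub> p t)"
    using R_subset by blast
  also have "\<dots> \<longleftrightarrow> r \<preceq>\<^bsub>MS\<^esub> G p"
    using le_G_iff[OF p _ power_memD[OF r]] by (simp add: le_power_iff G_closed r p)
  finally show ?thesis .
qed

lemma left_adjoint_P_G: "left_adjoint MS P G"
  using P_closed G_closed P_le_iff_le_G by (simp add: power.left_adjoint_iff)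

text \<open>
  A pointwise operation commutes with \<open>G\<close> as soon as its component map \<open>f\<close> preserves meets. The
  empty meet is included, as a point of \<open>S\<close> may have no successor.
\<close>

lemma G_commutes:
  assumes f: "\<And>p. p \<in> carrier MS \<Longrightarrow> F p \<in> carrier MS"
    and Ff: "\<And>p s. \<lbrakk>p \<in> carrier MS; s \<in> S\<rbrakk> \<Longrightarrow> F p s = f (p s)"
    and glb: "\<And>X m. \<lbrakk>X \<subseteq> carrier M; is_glb (eorder M) m X\<rbrakk> \<Longrightarrow> is_glb (eorder M) (f m) (f ` X)"
  shows "commutes_on (carrier MS) G F"
  unfolding commutes_on_def
proof
  fix p assume p: "p \<in> carrier MS"
  show "G (F p) = F (G p)"
  proof (rule power_eqI)
    fix s assume s: "s \<in> S"
    have "is_glb (eorder M) (f (G p s)) (f ` p ` (R `` {s}))"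
      by (intro glb image_closed p is_glb_G s)
    also have "f ` p ` (R `` {s}) = F p ` (R `` {s})"
      unfolding image_image using Ff[OF p] R_subset by (intro image_cong) auto
    finally have "G (F p) s = f (G p s)"
      using glb_unique is_glb_G[OF f[OF p] s] by blast
    then show "G (F p) s = F (G p) s"
      using Ff[OF G_closed[OF p] s] by simp
  qed (use p f G_closed in auto)
qed

lemma P_commutes:
  assumes f: "\<And>r. r \<in> carrier MS \<Longrightarrow> F r \<in> carrier MS"
    and Ff: "\<And>r t. \<lbrakk>r \<in> carrier MS; t \<in> S\<rbrakk> \<Longrightarrow> F r t = f (r t)"
    and lub: "\<And>X j. \<lbrakk>X \<subseteq> carrier M; is_lub (eorder M) j X\<rbrakk> \<Longrightarrow> is_lub (eorder M) (f j) (f ` X)"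
  shows "commutes_on (carrier MS) P F"
  unfolding commutes_on_def
proof
  fix r assume r: "r \<in> carrier MS"
  show "P (F r) = F (P r)"
  proof (rule power_eqI)
    fix t assume t: "t \<in> S"
    have "is_lub (eorder M) (f (P r t)) (f ` r ` (R\<inverse> `` {t}))"
      by (intro lub image_closed r is_lub_P t)
    also have "f ` r ` (R\<inverse> `` {t}) = F r ` (R\<inverse> `` {t})"
      unfolding image_image using Ff[OF r] R_subset by (intro image_cong) auto
    finally have "P (F r) t = f (P r t)"
      using lub_unique is_lub_P[OF f[OF r] t] by blast
    then show "P (F r) t = F (P r) t"
      using Ff[OF P_closed[OF r] t] by simp
  qed (use r f P_closed in auto)
qed

lemma galois_q_connection_P_G: "galois_q_connection MS P G"
  unfolding galois_q_connection_def
proof (intro conjI)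
  have q: "qop MS p \<in> carrier MS" "dop MS p \<in> carrier MS" if "p \<in> carrier MS" for p
    using power.qop_closed power.dop_closed that by auto
  have qs: "qop MS p s = qop M (p s)" "dop MS p s = dop M (p s)" if "s \<in> S" for p s
    using that by (simp_all add: power_sel)
  show "left_adjoint MS P G" by (rule left_adjoint_P_G)
  show "commutes_on (carrier MS) G (qop MS)" by (rule G_commutes[OF q(1) qs(1) qop_glb])
  show "commutes_on (carrier MS) G (dop MS)" by (rule G_commutes[OF q(2) qs(2) dop_glb])
  show "commutes_on (carrier MS) P (qop MS)" by (rule P_commutes[OF q(1) qs(1) qop_lub])
  show "commutes_on (carrier MS) P (dop MS)" by (rule P_commutes[OF q(2) qs(2) dop_lub])
qed

lemma converse_time_frame: "complete_linear_time_frame M S (R\<inverse>)"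
  using linear_q_effect_algebra_axioms q_effect_algebra_power_axioms complete R_subset
  by (auto intro!: complete_linear_time_frame.intro complete_linear_time_frame_axioms.intro)

text \<open>
  The De Morgan law for the meets that define \<open>H\<close>.
\<close>

lemma compl_H_compl_eq_P:
  assumes r: "r \<in> carrier MS"
  shows "ecompl MS (H_star M S R (ecompl MS r)) = P r"
proof -
  interpret conv: complete_linear_time_frame M S "R\<inverse>"
    by (rule converse_time_frame)
  have r': "ecompl MS r \<in> carrier MS" using r by (rule power.ecompl_closed)
  have H: "conv.G (ecompl MS r) \<in> carrier MS" using conv.G_closed[OF r'] .
  show ?thesis
    unfolding H_star_eq_G_star_converse
  proof (rule power_eqI)
    fix t assume t: "t \<in> S"
    have img: "ecompl M ` ecompl MS r ` (R\<inverse> `` {t}) = r ` (R\<inverse> `` {t})"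
      unfolding image_image
      using R_subset compl_compl power_memD[OF r] by (intro image_cong) (auto simp: compl_power[OF r])
    have "is_lub (eorder M) (ecompl M (conv.G (ecompl MS r) t)) (r ` (R\<inverse> `` {t}))"
      using lub_compl[OF conv.image_closed(1)[OF r'] conv.is_glb_G[OF r' t]] img by simp
    then have "ecompl M (conv.G (ecompl MS r) t) = P r t"
      using lub_unique is_lub_P[OF r t] by blast
    then show "ecompl MS (conv.G (ecompl MS r)) t = P r t"
      using t by (simp add: compl_power[OF H])
  qed (use H power.ecompl_closed P_closed r in auto)
qed

lemma q_tense_G_H: "q_tense_operators MS G (H_star M S R)"
proof -
  interpret conv: complete_linear_time_frame M S "R\<inverse>"
    by (rule converse_time_frame)
  let ?P = "\<lambda>x. ecompl MS (H_star M S R (ecompl MS x))"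
  have "?P x = P x" if "x \<in> carrier MS" for x
    using compl_H_compl_eq_P[OF that] .
  then have "galois_q_connection MS ?P G"
    using galois_q_connection_P_G P_closed power.qop_closed power.dop_closed
    by (simp add: galois_q_connection_def power.left_adjoint_iff commutes_on_def Pi_iff)
  then show ?thesis
    using power.q_effect_algebra_axioms G_closed conv.G_closed
    by (simp add: q_tense_operators_def H_star_eq_G_star_converse)
qed

lemma unit: "r \<in> carrier MS \<Longrightarrow> r \<preceq>\<^bsub>MS\<^esub> G (P r)"
  using P_le_iff_le_G P_closed power.le_refl by blast

lemma refl_G_le:
  assumes "refl_on S R" and p: "p \<in> carrier MS"
  shows "G p \<preceq>\<^bsub>MS\<^esub> p"
proof -
  have "G p s \<preceq>\<^bsub>M\<^esub> p s" if s: "s \<in> S" for s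
    using le_G_iff[OF p s power_memD[OF G_closed[OF p] s]] le_refl power_memD[OF G_closed[OF p] s]
      refl_onD[OF assms(1) s] by blast
  then show ?thesis using le_power_iff G_closed p by blast
qed

text \<open>
  With \<open>s R t\<close> and \<open>t R u\<close> also \<open>s R u\<close>; so every \<open>p u\<close> occurring in \<open>G (G p) s\<close> already
  occurs in the meet \<open>G p s\<close>.
\<close>

lemma trans_G_le_GG:
  assumes R: "trans R" and p: "p \<in> carrier MS"
  shows "G p \<preceq>\<^bsub>MS\<^esub> G (G p)"
proof -
  have "G p s \<preceq>\<^bsub>M\<^esub> G (G p) s" if s: "s \<in> S" for s
  proof -
    note c = power_memD[OF G_closed[OF p] s]
    have below: "G p s \<preceq>\<^bsub>M\<^esub> p u" if "(s, u) \<in> R" for u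
      using le_G_iff[OF p s c] le_refl[OF c] that by blast
    have "G p s \<preceq>\<^bsub>M\<^esub> G p t" if t: "(s, t) \<in> R" for t
      using le_G_iff[OF p _ c, of t] below transD[OF R t] R_subset t by blast
    then show ?thesis using le_G_iff[OF G_closed[OF p] s c] by blast
  qed
  then show ?thesis using le_power_iff G_closed p by blast
qed

text \<open>
  The two laws for \<open>P\<close> come from those for \<open>G\<close>: in \<open>r \<le> G (P r)\<close> the operator \<open>G\<close> may be
  dropped if \<open>R\<close> is reflexive, and repeated if \<open>R\<close> is transitive; in the second case the
  adjunction moves both copies to the left.
\<close>

lemma refl_le_P:
  assumes "refl_on S R" and r: "r \<in> carrier MS"
  shows "r \<preceq>\<^bsub>MS\<^esub> P r"
  using power.le_trans[OF r G_closed P_closed unit refl_G_le] P_closed assms by blast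

lemma trans_PP_le_P:
  assumes "trans R" and r: "r \<in> carrier MS"
  shows "P (P r) \<preceq>\<^bsub>MS\<^esub> P r"
proof -
  note Pr = P_closed[OF r] note GPr = G_closed[OF Pr]
  have "r \<preceq>\<^bsub>MS\<^esub> G (G (P r))"
    using power.le_trans[OF r GPr G_closed[OF GPr] unit[OF r] trans_G_le_GG[OF assms(1) Pr]] .
  then show ?thesis using P_le_iff_le_G r Pr GPr by blast
qed

lemma left_adjoint_eq_P: "\<lbrakk>left_adjoint MS f G; r \<in> carrier MS\<rbrakk> \<Longrightarrow> f r = P r"
  using power.left_adjoint_unique left_adjoint_P_G by blast

end

theorem corollary6:
  fixes M :: "'a q_effect_struct" and S :: "'s set" and R :: "('s \<times> 's) set"
  assumes "q_effect_algebra M"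
    and "total_order (eorder M)"
    and "complete_lattice (eorder M)"
    and "time_frame S R"
  shows "q_tense_operators (q_effect_power M S) (G_star M S R) (H_star M S R) \<and>
    (\<exists>P. left_adjoint (q_effect_power M S) P (G_star M S R)) \<and>
    (\<exists>F. left_adjoint (q_effect_power M S) F (H_star M S R)) \<and>
    (\<forall>P F. left_adjoint (q_effect_power M S) P (G_star M S R) \<and>
           left_adjoint (q_effect_power M S) F (H_star M S R) \<longrightarrow>
      (\<forall>r \<in> carrier (q_effect_power M S). \<forall>t\<in>S.
         P r t = \<Squnion>\<^bsub>eorder M\<^esub>{r s | s. s \<in> S \<and> (s, t) \<in> R} \<and>
         F r t = \<Squnion>\<^bsub>eorder M\<^esub>{r s | s. s \<in> S \<and> (t, s) \<in> R}) \<and>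
      (refl_on S R \<longrightarrow>
         (\<forall>p \<in> carrier (q_effect_power M S).
            G_star M S R p \<preceq>\<^bsub>q_effect_power M S\<^esub> p \<and>
            H_star M S R p \<preceq>\<^bsub>q_effect_power M S\<^esub> p) \<and>
         (\<forall>r \<in> carrier (q_effect_power M S).
            r \<preceq>\<^bsub>q_effect_power M S\<^esub> P r \<and>
            r \<preceq>\<^bsub>q_effect_power M S\<^esub> F r)) \<and>
      (sym R \<longrightarrow>
         (\<forall>p \<in> carrier (q_effect_power M S). G_star M S R p = H_star M S R p) \<and>
         (\<forall>r \<in> carrier (q_effect_power M S). P r = F r)) \<and>
      (trans R \<longrightarrow>
         (\<forall>p \<in> carrier (q_effect_power M S).
            G_star M S R p \<preceq>\<^bsub>q_effect_power M S\<^esub> G_star M S R (G_star M S R p) \<and>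
            H_star M S R p \<preceq>\<^bsub>q_effect_power M S\<^esub> H_star M S R (H_star M S R p)) \<and>
         (\<forall>r \<in> carrier (q_effect_power M S).
            P (P r) \<preceq>\<^bsub>q_effect_power M S\<^esub> P r \<and>
            F (F r) \<preceq>\<^bsub>q_effect_power M S\<^esub> F r)))"
proof -
  interpret fut: complete_linear_time_frame M S R
    using assms
    by (simp add: complete_linear_time_frame_def complete_linear_time_frame_axioms_def
        linear_q_effect_algebra_def linear_q_effect_algebra_axioms_def
        q_effect_algebra_power_def q_effect_algebra_power_axioms_def time_frame_def)
  interpret past: complete_linear_time_frame M S "R\<inverse>"
    by (rule fut.converse_time_frame)
  let ?MS = "q_effect_power M S"
  note H = H_star_eq_G_star_converse[of M S R]
  show ?thesis
    unfolding H
  proof (intro conjI allI impI ballI)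
    show "q_tense_operators ?MS (G_star M S R) (G_star M S (R\<inverse>))"
      using fut.q_tense_G_H unfolding H .
    show "\<exists>P. left_adjoint ?MS P (G_star M S R)"
      using fut.left_adjoint_P_G by blast
    show "\<exists>F. left_adjoint ?MS F (G_star M S (R\<inverse>))"
      using past.left_adjoint_P_G by blast
  next
    fix P F r t
    assume "left_adjoint ?MS P fut.G \<and> left_adjoint ?MS F past.G"
      and "r \<in> carrier ?MS" and "t \<in> S"
    then show "P r t = \<Squnion>\<^bsub>eorder M\<^esub>{r s | s. s \<in> S \<and> (s, t) \<in> R}"
      and "F r t = \<Squnion>\<^bsub>eorder M\<^esub>{r s | s. s \<in> S \<and> (t, s) \<in> R}"
      using fut.left_adjoint_eq_P past.left_adjoint_eq_P by (simp_all add: join_star_def)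
  next
    fix P F p
    assume "refl_on S R" and p: "p \<in> carrier ?MS"
    then show "fut.G p \<preceq>\<^bsub>?MS\<^esub> p" and "past.G p \<preceq>\<^bsub>?MS\<^esub> p"
      using fut.refl_G_le past.refl_G_le by simp_all
  next
    fix P F r
    assume "left_adjoint ?MS P fut.G \<and> left_adjoint ?MS F past.G"
      and "refl_on S R" and "r \<in> carrier ?MS"
    then show "r \<preceq>\<^bsub>?MS\<^esub> P r" and "r \<preceq>\<^bsub>?MS\<^esub> F r"
      using fut.left_adjoint_eq_P past.left_adjoint_eq_P fut.refl_le_P past.refl_le_P by simp_all
  next
    fix P F p
    assume "sym R"
    then show "fut.G p = past.G p" by (simp add: sym_conv_converse_eq)
  next
    fix P F r
    assume "left_adjoint ?MS P fut.G \<and> left_adjoint ?MS F past.G"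
      and "sym R" and "r \<in> carrier ?MS"
    then show "P r = F r"
      using fut.left_adjoint_eq_P past.left_adjoint_eq_P by (simp add: sym_conv_converse_eq)
  next
    fix P F p
    assume "trans R" and "p \<in> carrier ?MS"
    then show "fut.G p \<preceq>\<^bsub>?MS\<^esub> fut.G (fut.G p)" and "past.G p \<preceq>\<^bsub>?MS\<^esub> past.G (past.G p)"
      using fut.trans_G_le_GG past.trans_G_le_GG by simp_all
  next
    fix P F r
    assume "left_adjoint ?MS P fut.G \<and> left_adjoint ?MS F past.G"
      and "trans R" and "r \<in> carrier ?MS"
    then show "P (P r) \<preceq>\<^bsub>?MS\<^esub> P r" and "F (F r) \<preceq>\<^bsub>?MS\<^esub> F r"
      using fut.left_adjoint_eq_P past.left_adjoint_eq_P fut.trans_PP_le_P past.trans_PP_le_P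
        fut.P_closed past.P_closed by simp_all
  qed
qed

end
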